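(* Let $\mathbb{P}_\infty$ be the set of all odd integral multiples of $p$, and let $f : \mathbb{C} \setminus \mathbb{P}_\infty \to \mathbb{C}$ be the unique holomorphic function satisfying $f(0) = 0$ and $f'(z) = 1 + f(z)^2$ for all $z \in \mathbb{C} \setminus \mathbb{P}_\infty$. Then $f$ has neither $i$ nor $-i$ as a value; that is, $f(z) \neq i$ and $f(z) \neq -i$ for all $z \in \mathbb{C} \setminus \mathbb{P}_\infty$.
   Context: Write $B_r(0)$ for the open disc of radius $r$ about $0$ in $\mathbb{C}$. There is a unique holomorphic function $h : B_{1/2}(0) \to \mathbb{C}$ with $h(0)=0$ and $h' = 1 + h^2$; it takes values in the open unit disc. It extends to a holomorphic function $h : B_1(0) \to \mathbb{C}$, given by $z \mapsto \frac{2h(z/2)}{1 - h(z/2)^2}$ in terms of the original $h$ on $B_{1/2}(0)$, which again satisfies $h(0)=0$ and $h'=1+h^2$. It is real-valued on $(-1,1)$. The real number $p$ is the unique $p \in (0,2)$ such that $h(\tfrac12 p) = 1$; equivalently $\tfrac12 p = \int_0^1 \frac{dt}{1+t^2}$. The existence and uniqueness of the holomorphic function $f$ on $\mathbb{C} \setminus \mathbb{P}_\infty$ described in the claim is established in the paper and may be taken as given; $f$ extends $h$. *)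

theory Defs
  imports "HOL-Complex_Analysis.Complex_Analysis"
begin

definition is_solution_on :: "complex set \<Rightarrow> (complex \<Rightarrow> complex) \<Rightarrow> bool" where
  "is_solution_on S g \<longleftrightarrow>
     g holomorphic_on S \<and> g 0 = 0 \<and> (\<forall>z\<in>S. deriv g z = 1 + (g z)\<^sup>2)"

text \<open>
  The solution on the disc of radius 1/2. Functions are total, so it is pinned down by the
  value 0 outside the disc; otherwise the solution would not be unique as a total function.
\<close>

definition h_half :: "complex \<Rightarrow> complex" where
  "h_half = (THE g. is_solution_on (ball 0 (1/2)) g \<and> (\<forall>z. z \<notin> ball 0 (1/2) \<longrightarrow> g z = 0))"

text \<open>
  The extension to the unit disc by the duplication formula; only its values on
  \<^term>\<open>ball 0 1 :: complex set\<close> are meaningful.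
\<close>

definition h_disc :: "complex \<Rightarrow> complex" where
  "h_disc z = 2 * h_half (z / 2) / (1 - (h_half (z / 2))\<^sup>2)"

definition p_const :: real where
  "p_const = (THE x. 0 < x \<and> x < 2 \<and> h_disc (of_real (x / 2)) = 1)"

definition P_inf :: "complex set" where
  "P_inf = {of_real (of_int k * p_const) | k :: int. odd k}"

end

theory Submission
  imports Defs
begin

text \<open>
  Solutions of a linear equation \<open>u' = a u\<close> that vanish at a single point vanish identically.
  Applied to \<open>u = f \<mp> \<i>\<close>, where \<open>u' = (f \<plusminus> \<i>) u\<close>, it shows that \<open>f\<close> omits \<open>\<plusminus>\<i>\<close>, as \<open>f 0 = 0\<close>;
  applied to the difference \<open>u = g\<^sub>1 - g\<^sub>2\<close> of two solutions of \<open>g' = 1 + g\<^sup>2\<close>, where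
  \<open>u' = (g\<^sub>1 + g\<^sub>2) u\<close>, it identifies \<open>h\<close> with the tangent. The latter is needed for
  \<open>p \<noteq> 0\<close>, without which \<open>0\<close> would itself be a pole and \<open>f 0 = 0\<close> would say nothing.
\<close>

lemma linear_ode_zero:
  fixes u a :: "complex \<Rightarrow> complex"
  assumes "open S" "connected S" "a holomorphic_on S"
    and deriv: "\<And>z. z \<in> S \<Longrightarrow> (u has_field_derivative a z * u z) (at z)"
    and "z0 \<in> S" "u z0 = 0" "z \<in> S"
  shows "u z = 0"
proof -
  \<comment> \<open>\<open>S\<close> need not be simply connected, so a primitive \<open>A\<close>
    of \<open>a\<close> is taken only on a disc around \<open>z0\<close>. There the integrating
    factor \<open>exp (- A)\<close> makes \<open>u * exp (- A)\<close> constant; analytic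
    continuation carries \<open>u = 0\<close> from the disc to \<open>S\<close>.\<close>
  obtain r where r: "r > 0" "ball z0 r \<subseteq> S"
    using assms(1,5) openE by blast
  have "a holomorphic_on ball z0 r"
    using assms(3) r(2) holomorphic_on_subset by blast
  then obtain A where
    "\<And>x. x \<in> ball z0 r \<Longrightarrow> (A has_field_derivative a x) (at x within ball z0 r)"
    using holomorphic_convex_primitive'[OF convex_ball open_ball] by blast
  then have A: "(A has_field_derivative a x) (at x)" if "x \<in> ball z0 r" for x
    using that at_within_open[OF that open_ball] by metis
  have "((\<lambda>x. u x * exp (- A x)) has_field_derivative 0) (at x within ball z0 r)"
    if x: "x \<in> ball z0 r" for x
  proof -
    have u: "(u has_field_derivative a x * u x) (at x)"
      using x r(2) deriv by blast
    show ?thesis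
      by (rule has_field_derivative_at_within)
        (rule derivative_eq_intros u A[OF x] refl | simp add: algebra_simps)+
  qed
  then obtain c where c: "\<And>x. x \<in> ball z0 r \<Longrightarrow> u x * exp (- A x) = c"
    using has_field_derivative_zero_constant[OF convex_ball, of z0 r "\<lambda>x. u x * exp (- A x)"]
    by blast
  have zero: "u x = 0" if "x \<in> ball z0 r" for x
    using c[OF that] c[of z0] r(1) assms(6) by simp
  have "u holomorphic_on S"
    using assms(1) deriv holomorphic_on_open by blast
  then show ?thesis
    using analytic_continuation_open[of "ball z0 r" S u "\<lambda>_. 0" z] r assms zero by auto
qed

lemma solution_unique:
  assumes "open S" "connected S" "0 \<in> S" "is_solution_on S g1" "is_solution_on S g2" "z \<in> S"
  shows "g1 z = g2 z"
proof -
  have hol: "g1 holomorphic_on S" "g2 holomorphic_on S"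
    using assms(4,5) by (auto simp: is_solution_on_def)
  have "(g has_field_derivative 1 + (g x)\<^sup>2) (at x)" if "is_solution_on S g" "x \<in> S" for g x
    using that assms(1) holomorphic_derivI unfolding is_solution_on_def by metis
  then have "((\<lambda>x. g1 x - g2 x) has_field_derivative
      (1 + (g1 x)\<^sup>2) - (1 + (g2 x)\<^sup>2)) (at x)" if "x \<in> S" for x
    using that assms(4,5) by (intro DERIV_diff) blast+
  then have "((\<lambda>x. g1 x - g2 x) has_field_derivative (g1 x + g2 x) * (g1 x - g2 x)) (at x)"
    if "x \<in> S" for x
    using that by (simp add: algebra_simps power2_eq_square)
  moreover have "(\<lambda>x. g1 x + g2 x) holomorphic_on S"
    using hol by (intro holomorphic_intros)
  moreover have "g1 0 - g2 0 = 0"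
    using assms(4,5) by (simp add: is_solution_on_def)
  ultimately have "g1 z - g2 z = 0"
    by (intro linear_ode_zero[of S "\<lambda>x. g1 x + g2 x" "\<lambda>x. g1 x - g2 x" 0 z] assms(1-3,6))
  then show ?thesis by simp
qed

text \<open>All zeros of the complex cosine are real, and the real cosine is positive on (-pi/2,
  pi/2), which contains (-1, 1).\<close>

lemma cos_nonzero_unit_disc:
  fixes z :: complex
  assumes "norm z < 1"
  shows "cos z \<noteq> 0"
proof
  assume "cos z = 0"
  then obtain n :: int where "z = complex_of_real (n * pi) + of_real pi / 2"
    by (auto simp: cos_eq_0)
  then have z: "z = of_real (n * pi + pi / 2)"
    by simp
  then have "\<bar>n * pi + pi / 2\<bar> < 1"
    using assms norm_of_real by metis
  moreover have "cos (n * pi + pi / 2) = 0"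
    using \<open>cos z = 0\<close> unfolding z cos_of_real by (simp only: of_real_eq_0_iff)
  ultimately show False
    using cos_gt_zero_pi[of "n * pi + pi / 2"] pi_gt3 by (simp only: abs_less_iff) linarith
qed

lemma h_half_eq_tan:
  assumes "norm z < 1 / 2"
  shows "h_half z = tan z"
proof -
  let ?B = "ball 0 (1/2) :: complex set"
  \<comment> \<open>The cut-off to 0 matches the normalisation in \<open>h_half\<close>;
    \<open>tan\<close> itself would fail it outside the disc.\<close>
  let ?g = "\<lambda>z. if z \<in> ?B then tan z else 0"
  let ?P = "\<lambda>g. is_solution_on ?B g \<and> (\<forall>z. z \<notin> ?B \<longrightarrow> g z = 0)"
  have tan: "(tan has_field_derivative 1 + (tan z)\<^sup>2) (at z)" if "z \<in> ?B" for z
  proof -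
    have "cos z \<noteq> 0" using that cos_nonzero_unit_disc[of z] by auto
    then show ?thesis
      using DERIV_tan[of z] tan_sec[of z] by (simp add: power_inverse)
  qed
  have der: "(?g has_field_derivative 1 + (?g z)\<^sup>2) (at z)" if "z \<in> ?B" for z
    by (rule DERIV_cong_ev[THEN iffD1, OF refl _ _ tan[OF that]])
      (use that in \<open>auto intro!: eventually_mono[OF eventually_nhds_in_open[of ?B z]]\<close>)
  have "?g holomorphic_on ?B"
    unfolding holomorphic_on_open[OF open_ball] using der by blast
  then have "?P ?g"
    unfolding is_solution_on_def using DERIV_imp_deriv[OF der] by auto
  moreover have "g = ?g" if "?P g" for g
  proof
    fix z show "g z = ?g z"
      using solution_unique[of ?B g ?g z] that \<open>?P ?g\<close> by (cases "z \<in> ?B") auto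
  qed
  ultimately have "h_half = ?g"
    unfolding h_half_def by (rule the_equality)
  then show ?thesis using assms by (simp add: fun_eq_iff)
qed

text \<open>The formula defining \<open>h_disc\<close> is the duplication formula of the tangent,
  valid where the cosines of \<open>z / 2\<close> and \<open>z\<close> do not vanish.\<close>

lemma h_disc_eq_tan:
  assumes "norm z < 1"
  shows "h_disc z = tan z"
proof -
  have "cos (z / 2) \<noteq> 0" "cos z \<noteq> 0"
    using assms by (intro cos_nonzero_unit_disc; simp add: norm_divide)+
  then show ?thesis
    using assms tan_double[of "z / 2"]
    by (simp add: h_disc_def h_half_eq_tan norm_divide)
qed

lemma p_const_eq: "p_const = pi / 2"
  unfolding p_const_def
proof (rule the_equality)
  have "h_disc (of_real (pi / 2 / 2)) = of_real (tan (pi / 4))"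
    using pi_less_4 by (subst h_disc_eq_tan) (auto simp: tan_of_real simp flip: of_real_divide)
  then show "0 < pi / 2 \<and> pi / 2 < 2 \<and> h_disc (of_real (pi / 2 / 2)) = 1"
    using pi_less_4 by (simp add: tan_45)
next
  fix x :: real
  assume x: "0 < x \<and> x < 2 \<and> h_disc (of_real (x / 2)) = 1"
  then have "h_disc (of_real (x / 2)) = of_real (tan (x / 2))"
    by (subst h_disc_eq_tan) (auto simp: tan_of_real simp flip: of_real_divide)
  then have "complex_of_real (tan (x / 2)) = of_real 1"
    using x by (metis of_real_1)
  then have "tan (x / 2) = 1"
    by (simp only: of_real_eq_iff)
  \<comment> \<open>From \<open>x < 2\<close> and \<open>pi > 3\<close>, \<open>x / 2\<close> lies
    below pi/2, so in the principal branch of the tangent.\<close>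
  then have "arctan 1 = x / 2"
    using x pi_gt3 by (intro arctan_unique) auto
  then show "x = pi / 2"
    by simp
qed

text \<open>As a scaled set of integers, \<open>P_inf\<close> is visibly closed and countable, so
  its complement is open and connected.\<close>

lemma P_inf_eq: "P_inf = (\<lambda>z. (pi / 2) *\<^sub>R z) ` (of_int ` {k. odd k})"
  by (auto simp: P_inf_def p_const_eq scaleR_conv_of_real image_iff mult.commute)

lemma closed_P_inf: "closed P_inf"
  unfolding P_inf_eq by (intro closed_scaling closed_subset_Ints) auto

lemma countable_P_inf: "countable P_inf"
  unfolding P_inf_eq by (intro countable_image) auto

lemma zero_notin_P_inf: "0 \<notin> P_inf"
  unfolding P_inf_eq by auto

theorem theorem8:
  fixes f :: "complex \<Rightarrow> complex"
  assumes "f holomorphic_on (- P_inf)"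
    and "f 0 = 0"
    and "\<forall>z \<in> - P_inf. deriv f z = 1 + (f z)\<^sup>2"
  shows "\<forall>z \<in> - P_inf. f z \<noteq> \<i> \<and> f z \<noteq> - \<i>"
proof -
  have op: "open (- P_inf)" and conn: "connected (- P_inf)"
    using closed_P_inf path_connected_complement_countable[OF _ countable_P_inf]
    by (auto intro: path_connected_imp_connected)
  \<comment> \<open>Both values are treated at once: \<open>c\<^sup>2 = -1\<close> is all that the
    factorisation of 1 + f^2 into (f + c)(f - c) needs.\<close>
  have omits: "f z \<noteq> c" if c: "c\<^sup>2 = -1" and z: "z \<in> - P_inf" for c z
  proof
    assume "f z = c"
    have "(f has_field_derivative 1 + (f x)\<^sup>2) (at x)" if "x \<in> - P_inf" for x
      using holomorphic_derivI[OF assms(1) op that] assms(3) that by metis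
    then have "((\<lambda>x. f x - c) has_field_derivative (f x + c) * (f x - c)) (at x)"
      if "x \<in> - P_inf" for x
      using that c
      by (auto intro!: derivative_eq_intros simp: algebra_simps power2_eq_square)
    moreover have "(\<lambda>x. f x + c) holomorphic_on - P_inf"
      using assms(1) by (intro holomorphic_intros)
    \<comment> \<open>The zero of \<open>f - c\<close> at \<open>z\<close> propagates back to 0,
      which lies in the domain by \<open>zero_notin_P_inf\<close>.\<close>
    ultimately have "f 0 - c = 0"
      using linear_ode_zero[OF op conn, of "\<lambda>x. f x + c" "\<lambda>x. f x - c" z 0]
        \<open>f z = c\<close> z zero_notin_P_inf by (metis ComplI diff_self)
    then show False using assms(2) c by simp
  qed
  then show ?thesis by simp
qed

end
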